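(* Let $3 \le d \le q$ and let $\mathcal{C} \subset \mathbb{P}^2$ be a projective plane curve of degree $d$ defined over $\mathbb{F}_q$. If $|\mathcal{C}(\mathbb{F}_q)| < dq + 1$, then $|\mathcal{C}(\mathbb{F}_q)| \le dq - d + 3$.
   Context: $\mathbb{F}_q$ is the finite field with $q$ elements. A projective plane curve of degree $d$ defined over $\mathbb{F}_q$ is the zero set in $\mathbb{P}^2$ of a nonzero homogeneous polynomial of degree $d$ in three variables over $\mathbb{F}_q$; $\mathcal{C}(\mathbb{F}_q)$ denotes its set of $\mathbb{F}_q$-rational points. *)

theory Defs
  imports Main
begin

definition deg_monomials :: "nat \<Rightarrow> (nat \<times> nat \<times> nat) set" where
  "deg_monomials d = {(i, j, k). i + j + k = d}"

(* A homogeneous polynomial of degree d in three variables is given by its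
  coefficient function on deg_monomials d (values outside deg_monomials d are ignored).
  It is nonzero iff some coefficient on deg_monomials d is nonzero. *)
definition hom_nonzero :: "(nat \<times> nat \<times> nat \<Rightarrow> 'a::zero) \<Rightarrow> nat \<Rightarrow> bool" where
  "hom_nonzero c d \<longleftrightarrow> (\<exists>m\<in>deg_monomials d. c m \<noteq> 0)"

definition hom_eval :: "(nat \<times> nat \<times> nat \<Rightarrow> 'a::comm_ring_1) \<Rightarrow> nat \<Rightarrow> 'a \<times> 'a \<times> 'a \<Rightarrow> 'a" where
  "hom_eval c d p = (\<Sum>(i, j, k)\<in>deg_monomials d.
      c (i, j, k) * fst p ^ i * fst (snd p) ^ j * snd (snd p) ^ k)"

(* Proportionality of nonzero triples; its classes are the points of P^2. *)
definition proj_rel :: "('a::field \<times> 'a \<times> 'a) rel" where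
  "proj_rel = {(u, v). u \<noteq> (0, 0, 0) \<and> v \<noteq> (0, 0, 0) \<and>
      (\<exists>l. l \<noteq> 0 \<and> fst v = l * fst u \<and> fst (snd v) = l * fst (snd u)
               \<and> snd (snd v) = l * snd (snd u))}"

definition curve_points :: "(nat \<times> nat \<times> nat \<Rightarrow> 'a::field) \<Rightarrow> nat \<Rightarrow> ('a \<times> 'a \<times> 'a) set set" where
  "curve_points c d = {u. u \<noteq> (0, 0, 0) \<and> hom_eval c d u = 0} // proj_rel"

end

theory Submission
  imports Defs "HOL-Library.Product_Plus" "HOL-Library.Cardinality" "HOL-Computational_Algebra.Polynomial"
begin

text \<open>
  Points are counted as nonzero vectors up to scaling, and the line with coordinate vector \<open>a\<close> is
  the set of points orthogonal to \<open>a\<close>; let \<open>q\<close> be the size of the field.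

  If two distinct lines lie in the curve, let \<open>p\<close> be their common point and \<open>m \<ge> 2\<close> the number of
  lines through \<open>p\<close> inside the curve. If \<open>m \<ge> d\<close> there are at least \<open>dq + 1\<close> points. Otherwise \<open>p\<close> has
  multiplicity at least \<open>m\<close>, so each of the remaining \<open>q + 1 - m\<close> lines through \<open>p\<close> has at most \<open>d - m\<close>
  further points, and the number of points is at most
  \<open>1 + mq + (q + 1 - m)(d - m) = dq + 1 - (m - 1)(d - m) \<le> dq - d + 3\<close>.

  If the curve contains \<open>k \<le> 1\<close> lines, let \<open>M\<close> be the number of its points off these lines. Each of
  them lies on \<open>q + 1\<close> lines, at least one of which is tangent to the curve there, while a line meets
  the curve in at most \<open>d\<close> points even if tangencies count twice. Hence
  \<open>M(q + 2) \<le> (d - k)(q\<^sup>2 + q + 1 - k)\<close>, which suffices because \<open>d \<le> q\<close>.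
\<close>

declare split_paired_All [simp del] split_paired_Ex [simp del]

section \<open>Scaling and the dot product on coordinate triples\<close>

definition smul :: "'a::comm_ring_1 \<Rightarrow> 'a \<times> 'a \<times> 'a \<Rightarrow> 'a \<times> 'a \<times> 'a" (infixr "\<bullet>" 75) where
  "l \<bullet> u = (l * fst u, l * fst (snd u), l * snd (snd u))"

definition dot :: "'a::comm_ring_1 \<times> 'a \<times> 'a \<Rightarrow> 'a \<times> 'a \<times> 'a \<Rightarrow> 'a" where
  "dot a u = fst a * fst u + fst (snd a) * fst (snd u) + snd (snd a) * snd (snd u)"

abbreviation perp :: "'a::comm_ring_1 \<times> 'a \<times> 'a \<Rightarrow> ('a \<times> 'a \<times> 'a) set" where
  "perp a \<equiv> {u. dot a u = 0}"

lemma dot_add_right [simp]: "dot a (u + v) = dot a u + dot a v"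
  by (simp add: dot_def algebra_simps)

lemma dot_diff_right [simp]: "dot a (u - v) = dot a u - dot a v"
  by (simp add: dot_def algebra_simps)

lemma dot_add_left [simp]: "dot (a + b) u = dot a u + dot b u"
  by (simp add: dot_def algebra_simps)

lemma dot_smul_right [simp]: "dot a (l \<bullet> u) = l * dot a u"
  by (simp add: dot_def smul_def algebra_simps)

lemma dot_smul_left [simp]: "dot (l \<bullet> a) u = l * dot a u"
  by (simp add: dot_def smul_def algebra_simps)

lemma dot_zero_right [simp]: "dot a 0 = 0"
  by (simp add: dot_def)

lemma dot_zero_left [simp]: "dot 0 a = 0"
  by (simp add: dot_def)

lemma dot_commute: "dot a u = dot u a"
  by (simp add: dot_def algebra_simps)

lemma smul_zero_left [simp]: "0 \<bullet> u = 0"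
  by (simp add: smul_def zero_prod_def)

lemma smul_zero_right [simp]: "l \<bullet> 0 = 0"
  by (simp add: smul_def zero_prod_def)

lemma smul_one [simp]: "1 \<bullet> u = u"
  by (simp add: smul_def)

lemma smul_smul [simp]: "k \<bullet> l \<bullet> u = (k * l) \<bullet> u"
  by (simp add: smul_def algebra_simps)

lemma smul_add_right: "l \<bullet> (u + v) = l \<bullet> u + l \<bullet> v"
  by (simp add: smul_def prod_eq_iff algebra_simps)

lemma smul_diff_left: "(k - l) \<bullet> u = k \<bullet> u - l \<bullet> u"
  by (simp add: smul_def prod_eq_iff algebra_simps)

lemma smul_eq_0_iff [simp]:
  fixes u :: "'a::field \<times> 'a \<times> 'a"
  shows "l \<bullet> u = 0 \<longleftrightarrow> l = 0 \<or> u = 0"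
  by (auto simp: smul_def prod_eq_iff)

lemma smul_left_cancel:
  fixes u :: "'a::field \<times> 'a \<times> 'a"
  assumes "u \<noteq> 0" "k \<bullet> u = l \<bullet> u"
  shows "k = l"
proof -
  have "(k - l) \<bullet> u = 0" using assms by (simp add: smul_diff_left)
  with assms(1) show ?thesis by simp
qed

lemma exists_dot_nonzero:
  fixes a :: "'a::field \<times> 'a \<times> 'a"
  assumes "a \<noteq> 0"
  obtains u where "dot a u \<noteq> 0"
proof -
  have "dot a (1, 0, 0) \<noteq> 0 \<or> dot a (0, 1, 0) \<noteq> 0 \<or> dot a (0, 0, 1) \<noteq> 0"
    using assms by (auto simp: dot_def prod_eq_iff)
  with that show thesis by blast
qed

section \<open>Counting vectors\<close>

text \<open>Projection along \<open>p\<close> onto the plane \<open>perp a\<close>: the coefficient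
  of \<open>p\<close> in \<open>u\<close> is forced to be \<open>dot a u / dot a p\<close>. This
  counts the plane, and it also sorts all vectors by the lines through the point
  \<open>p\<close>.\<close>

lemma bij_betw_perp_times_line:
  fixes a p :: "'a::field \<times> 'a \<times> 'a"
  assumes "dot a p \<noteq> 0"
  shows "bij_betw (\<lambda>(v, s). v + s \<bullet> p) (perp a \<times> UNIV) UNIV"
proof (rule bij_betw_byWitness[where f' = "\<lambda>u. (u - (dot a u / dot a p) \<bullet> p, dot a u / dot a p)"])
qed (use assms in auto)

lemma card_field_ge_2: "2 \<le> CARD('a::{field, finite})"
proof -
  have "card {0, 1 :: 'a} \<le> CARD('a)" by (rule card_mono) auto
  then show ?thesis by simp
qed

lemma card_perp:
  fixes a :: "'a::{field, finite} \<times> 'a \<times> 'a"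
  assumes "a \<noteq> 0"
  shows "card (perp a) = CARD('a)\<^sup>2"
proof -
  obtain p where "dot a p \<noteq> 0" using exists_dot_nonzero[OF assms] .
  from bij_betw_same_card[OF bij_betw_perp_times_line[OF this]]
  show ?thesis by (simp add: card_cartesian_product power2_eq_square)
qed

lemma card_perp_minus_zero:
  fixes a :: "'a::{field, finite} \<times> 'a \<times> 'a"
  assumes "a \<noteq> 0"
  shows "card (perp a - {0}) = (CARD('a) - 1) * (CARD('a) + 1)"
proof -
  have "card (perp a - {0}) = CARD('a)\<^sup>2 - 1"
    using card_perp[OF assms] by (subst card_Diff_singleton) auto
  then show ?thesis by (simp add: power2_eq_square algebra_simps)
qed

text \<open>Two lines meet: by pigeonhole, q^3 vectors share at most q^2 pairs of values, and the
  difference of two vectors with equal values is a nonzero solution.\<close>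

lemma exists_common_perp:
  fixes a b :: "'a::{field, finite} \<times> 'a \<times> 'a"
  obtains u where "u \<noteq> 0" "dot a u = 0" "dot b u = 0"
proof -
  let ?f = "\<lambda>u. (dot a u, dot b u)"
  have "\<not> inj ?f"
  proof
    assume "inj ?f"
    then have "CARD('a \<times> 'a \<times> 'a) \<le> CARD('a \<times> 'a)" by (intro card_inj_on_le[of ?f]) auto
    then show False using card_field_ge_2[where 'a = 'a] by simp
  qed
  then obtain u v where uv: "u \<noteq> v" "?f u = ?f v" unfolding inj_def by blast
  show thesis by (rule that[of "u - v"]) (use uv in auto)
qed

text \<open>Independence of \<open>v\<close> and \<open>w\<close> gives injectivity. The range then
  has q^2 elements, as many as the plane, so it is the whole plane.\<close>

lemma bij_betw_basis_perp:
  fixes a v w :: "'a::{field, finite} \<times> 'a \<times> 'a"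
  assumes "a \<noteq> 0" "v \<in> perp a" "w \<in> perp a" "w \<noteq> 0" "v \<notin> range (\<lambda>s. s \<bullet> w)"
  shows "bij_betw (\<lambda>(t, s). t \<bullet> v + s \<bullet> w) UNIV (perp a)"
proof -
  let ?f = "\<lambda>(t, s). t \<bullet> v + s \<bullet> w"
  have "inj ?f"
  proof (rule injI, clarify)
    fix t s t' s'
    assume eq: "t \<bullet> v + s \<bullet> w = t' \<bullet> v + s' \<bullet> w"
    then have eq': "(t - t') \<bullet> v = (s' - s) \<bullet> w"
      by (simp add: smul_diff_left algebra_simps)
    have "t = t'"
    proof (rule ccontr)
      assume "t \<noteq> t'"
      then have "v = (inverse (t - t') * (t - t')) \<bullet> v" by simp
      also have "\<dots> = (inverse (t - t') * (s' - s)) \<bullet> w"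
        unfolding smul_smul[symmetric] eq' ..
      finally show False using assms(5) by blast
    qed
    then show "t = t' \<and> s = s'" using eq smul_left_cancel[OF assms(4)] by auto
  qed
  moreover have "range ?f \<subseteq> perp a" using assms by auto
  moreover have "card (range ?f) = card (perp a)"
    using card_image[OF \<open>inj ?f\<close>] card_perp[OF assms(1)] by (simp add: power2_eq_square)
  ultimately show ?thesis by (metis bij_betw_def card_subset_eq finite)
qed

lemma basis_perp_extend:
  fixes a w :: "'a::{field, finite} \<times> 'a \<times> 'a"
  assumes "a \<noteq> 0" "w \<in> perp a" "w \<noteq> 0"
  obtains v where "v \<in> perp a" "bij_betw (\<lambda>(t, s). t \<bullet> v + s \<bullet> w) UNIV (perp a)"
proof -
  have "card (range (\<lambda>s. s \<bullet> w)) \<le> CARD('a)" by (rule card_image_le) simp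
  also have "\<dots> < card (perp a)"
    using card_perp[OF assms(1)] card_field_ge_2[where 'a = 'a] by (simp add: power2_eq_square)
  finally have "\<not> perp a \<subseteq> range (\<lambda>s. s \<bullet> w)"
    using card_mono[of "range (\<lambda>s. s \<bullet> w)" "perp a"] by (meson finite leD)
  then obtain v where "v \<in> perp a" "v \<notin> range (\<lambda>s. s \<bullet> w)" by blast
  with that bij_betw_basis_perp assms show thesis by blast
qed

section \<open>Scaling-invariant sets of vectors and their projective points\<close>

definition cone :: "('a::field \<times> 'a \<times> 'a) set \<Rightarrow> bool" where
  "cone X \<longleftrightarrow> 0 \<notin> X \<and> (\<forall>u\<in>X. \<forall>l. l \<noteq> 0 \<longrightarrow> l \<bullet> u \<in> X)"

lemma proj_rel_iff: "(u, v) \<in> proj_rel \<longleftrightarrow> u \<noteq> 0 \<and> (\<exists>l. l \<noteq> 0 \<and> v = l \<bullet> u)"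
  by (auto simp: proj_rel_def smul_def prod_eq_iff)

lemma equiv_proj_rel: "equiv (- {0 :: 'a::field \<times> 'a \<times> 'a}) proj_rel" (is "equiv ?A ?r")
proof (rule equivI)
  show "?r \<subseteq> ?A \<times> ?A" by (auto simp: proj_rel_iff)
  show "refl_on ?A ?r"
    by (auto simp: refl_on_def proj_rel_iff intro: exI[of _ 1])
  show "sym ?r"
  proof (rule symI)
    fix u v :: "'a \<times> 'a \<times> 'a"
    assume "(u, v) \<in> proj_rel"
    then obtain l where "u \<noteq> 0" "l \<noteq> 0" "v = l \<bullet> u" by (auto simp: proj_rel_iff)
    then have "v \<noteq> 0 \<and> inverse l \<noteq> 0 \<and> u = inverse l \<bullet> v" by simp
    then show "(v, u) \<in> proj_rel" unfolding proj_rel_iff by blast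
  qed
  show "trans ?r"
  proof (rule transI)
    fix u v w :: "'a \<times> 'a \<times> 'a"
    assume "(u, v) \<in> proj_rel" "(v, w) \<in> proj_rel"
    then obtain k l where "u \<noteq> 0" "k \<noteq> 0" "v = k \<bullet> u" "l \<noteq> 0" "w = l \<bullet> v"
      by (auto simp: proj_rel_iff)
    then have "l * k \<noteq> 0 \<and> w = (l * k) \<bullet> u" by simp
    with \<open>u \<noteq> 0\<close> show "(u, w) \<in> proj_rel" unfolding proj_rel_iff by blast
  qed
qed

lemma card_punctured_line:
  fixes u :: "'a::{field, finite} \<times> 'a \<times> 'a"
  assumes "u \<noteq> 0"
  shows "card ((\<lambda>l. l \<bullet> u) ` (- {0})) = CARD('a) - 1"
proof -
  have "inj_on (\<lambda>l. l \<bullet> u) (- {0})" using smul_left_cancel[OF assms] by (auto intro: inj_onI)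
  then show ?thesis by (simp add: card_image Compl_eq_Diff_UNIV card_Diff_singleton)
qed

text \<open>Every class is a punctured line of q - 1 vectors. Points can therefore be counted as
  vectors, without choosing representatives; the factor q - 1 is cancelled at the end.\<close>

lemma card_cone:
  fixes X :: "('a::{field, finite} \<times> 'a \<times> 'a) set"
  assumes "cone X"
  shows "card X = (CARD('a) - 1) * card (X // proj_rel)"
proof -
  have cls: "proj_rel `` {u} = (\<lambda>l. l \<bullet> u) ` (- {0})" if "u \<in> X" for u
    using that assms by (auto simp: cone_def proj_rel_iff)
  have "X \<subseteq> - {0}" using assms by (auto simp: cone_def)
  then have sub: "X // proj_rel \<subseteq> (- {0}) // proj_rel"
    unfolding quotient_def by (rule UN_mono) simp
  have "\<Union> (X // proj_rel) = X"
  proof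
    show "\<Union> (X // proj_rel) \<subseteq> X"
    proof
      fix v assume "v \<in> \<Union> (X // proj_rel)"
      then obtain u where u: "u \<in> X" "v \<in> proj_rel `` {u}" by (auto simp: quotient_def)
      then obtain l where "l \<noteq> 0" "v = l \<bullet> u" unfolding cls[OF u(1)] by blast
      with u(1) assms show "v \<in> X" unfolding cone_def by blast
    qed
    show "X \<subseteq> \<Union> (X // proj_rel)"
    proof
      fix u assume u: "u \<in> X"
      have "u \<in> (\<lambda>l. l \<bullet> u) ` (- {0})" by (auto intro: image_eqI[of _ _ 1])
      with u show "u \<in> \<Union> (X // proj_rel)" by (auto simp: quotient_def cls)
    qed
  qed
  moreover have "(CARD('a) - 1) * card (X // proj_rel) = card (\<Union> (X // proj_rel))"
  proof (rule card_partition)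
    fix c assume "c \<in> X // proj_rel"
    then obtain u where u: "u \<in> X" "c = proj_rel `` {u}" by (rule quotientE)
    then have "u \<noteq> 0" using assms by (auto simp: cone_def)
    then show "card c = CARD('a) - 1" using cls[OF u(1)] u(2) card_punctured_line by simp
  next
    fix b c assume "b \<in> X // proj_rel" "c \<in> X // proj_rel" "b \<noteq> c"
    then show "b \<inter> c = {}" using quotient_disj[OF equiv_proj_rel, of b c] sub by auto
  qed auto
  ultimately show ?thesis by simp
qed

section \<open>Forms\<close>

text \<open>Homogeneity is recorded by the way a function is built, so that derivatives and Taylor
  expansions can be obtained by induction. The zero function is a form of every degree.\<close>

inductive form :: "nat \<Rightarrow> ('a::comm_ring_1 \<times> 'a \<times> 'a \<Rightarrow> 'a) \<Rightarrow> bool" where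
  const: "form 0 (\<lambda>_. k)"
| linear: "form 1 (dot a)"
| add: "form n f \<Longrightarrow> form n g \<Longrightarrow> form n (\<lambda>u. f u + g u)"
| mult: "form m f \<Longrightarrow> form n g \<Longrightarrow> form (m + n) (\<lambda>u. f u * g u)"

lemma form_zero: "form n (\<lambda>_. 0)"
proof (induction n)
  case 0
  show ?case by (rule form.const)
next
  case (Suc n)
  from form.mult[OF form.linear[of 0] this] show ?case by simp
qed

lemma form_sum:
  assumes "\<And>i. i \<in> I \<Longrightarrow> form n (f i)"
  shows "form n (\<lambda>u. \<Sum>i\<in>I. f i u)"
  using assms by (induction I rule: infinite_finite_induct) (auto intro: form_zero form.add)

lemma form_power: "form m f \<Longrightarrow> form (m * n) (\<lambda>u. f u ^ n)"
proof (induction n)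
  case 0
  show ?case using form.const[of 1] by simp
next
  case (Suc n)
  from form.mult[OF Suc.prems Suc.IH[OF Suc.prems]] show ?case by (simp add: algebra_simps)
qed

lemma form_hom_eval: "form d (hom_eval c d)"
proof -
  have "form d (\<lambda>p. case m of (i, j, k) \<Rightarrow> c (i, j, k) * fst p ^ i * fst (snd p) ^ j * snd (snd p) ^ k)"
    if m: "m \<in> deg_monomials d" for m
  proof -
    obtain i j k where ijk: "m = (i, j, k)" "i + j + k = d"
      using m by (auto simp: deg_monomials_def)
    \<comment> \<open>The coordinates are dot products with the unit vectors, so a monomial is a
      constant times a product of linear forms.\<close>
    have "form (0 + (1 * i) + (1 * j) + (1 * k))
        (\<lambda>p. c (i, j, k) * dot (1, 0, 0) p ^ i * dot (0, 1, 0) p ^ j * dot (0, 0, 1) p ^ k)"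
      by (intro form.mult form_power form.linear form.const)
    then show ?thesis by (simp add: ijk dot_def)
  qed
  from form_sum[OF this] show ?thesis by (simp add: hom_eval_def[abs_def])
qed

lemma form_smul: "form n f \<Longrightarrow> f (l \<bullet> u) = l ^ n * f u"
  by (induction rule: form.induct) (auto simp: algebra_simps power_add)

section \<open>Restriction of forms to parametrised lines\<close>

lemma coeff_mult_degree_le:
  assumes "degree p \<le> m" "degree q \<le> n"
  shows "coeff (p * q) (m + n) = coeff p m * coeff q n"
proof (cases "degree p = m \<and> degree q = n")
  case True
  then show ?thesis by (auto simp: coeff_mult_degree_sum)
next
  case False
  with assms have "degree p < m \<or> degree q < n" "degree (p * q) < m + n"
    using degree_mult_le[of p q] by linarith+
  then show ?thesis by (auto simp: coeff_eq_0)
qed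

text \<open>Here \<open>g\<close> plays the part of the vector of formal partial derivatives. Over a
  finite field the values of \<open>f\<close> do not determine it, so its properties are recorded
  instead: Euler's identity, homogeneity of degree d - 1 (multiplied by \<open>t\<close> to avoid
  the subtraction), and the directional derivative along every line. The coefficient at
  \<open>d\<close> is the value at infinity on that line.\<close>

definition gradient ::
  "nat \<Rightarrow> ('a::idom \<times> 'a \<times> 'a \<Rightarrow> 'a) \<Rightarrow> ('a \<times> 'a \<times> 'a \<Rightarrow> 'a \<times> 'a \<times> 'a) \<Rightarrow> bool" where
  "gradient d f g \<longleftrightarrow>
    (\<forall>u. dot (g u) u = of_nat d * f u) \<and>
    (\<forall>t u. t \<bullet> g (t \<bullet> u) = t ^ d \<bullet> g u) \<and>
    (\<forall>v w. \<exists>p. degree p \<le> d \<and> coeff p d = f w \<and> (\<forall>s. poly p s = f (v + s \<bullet> w)) \<and>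
      (\<forall>s. poly (pderiv p) s = dot (g (v + s \<bullet> w)) w))"

lemma gradient_polyE:
  assumes "gradient d f g"
  obtains p where "degree p \<le> d" "coeff p d = f w" "\<forall>s. poly p s = f (v + s \<bullet> w)"
    "\<forall>s. poly (pderiv p) s = dot (g (v + s \<bullet> w)) w"
  using assms unfolding gradient_def by blast

lemma gradient_euler: "gradient d f g \<Longrightarrow> dot (g u) u = of_nat d * f u"
  by (simp add: gradient_def)

lemma gradient_smul: "gradient d f g \<Longrightarrow> t \<bullet> g (t \<bullet> u) = t ^ d \<bullet> g u"
  by (simp add: gradient_def)

lemma form_gradient:
  fixes f :: "'a::idom \<times> 'a \<times> 'a \<Rightarrow> 'a"
  assumes "form d f"
  shows "\<exists>g. gradient d f g"
  using assms
proof induction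
  case (const k)
  show ?case unfolding gradient_def by (rule exI[of _ "\<lambda>_. 0"]) (auto intro!: exI[of _ "[:k:]"])
next
  case (linear a)
  have "\<exists>p. degree p \<le> 1 \<and> coeff p 1 = dot a w \<and> (\<forall>s. poly p s = dot a (v + s \<bullet> w)) \<and>
        (\<forall>s. poly (pderiv p) s = dot a w)" for v w
    by (rule exI[of _ "[:dot a v, dot a w:]"]) (simp add: pderiv_pCons)
  then show ?case unfolding gradient_def by (intro exI[of _ "\<lambda>_. a"]) simp
next
  case (add n f1 f2)
  then obtain g1 g2 where g1: "gradient n f1 g1" and g2: "gradient n f2 g2" by blast
  have "gradient n (\<lambda>u. f1 u + f2 u) (\<lambda>u. g1 u + g2 u)"
    unfolding gradient_def
  proof (intro conjI allI)
    fix u show "dot (g1 u + g2 u) u = of_nat n * (f1 u + f2 u)"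
      by (simp add: gradient_euler[OF g1] gradient_euler[OF g2] algebra_simps)
  next
    fix t u show "t \<bullet> (g1 (t \<bullet> u) + g2 (t \<bullet> u)) = t ^ n \<bullet> (g1 u + g2 u)"
      by (simp add: gradient_smul[OF g1] gradient_smul[OF g2] smul_add_right)
  next
    fix v w
    obtain p where p: "degree p \<le> n" "coeff p n = f1 w" "\<forall>s. poly p s = f1 (v + s \<bullet> w)"
      "\<forall>s. poly (pderiv p) s = dot (g1 (v + s \<bullet> w)) w" using gradient_polyE[OF g1, where v = v and w = w] .
    obtain q where q: "degree q \<le> n" "coeff q n = f2 w" "\<forall>s. poly q s = f2 (v + s \<bullet> w)"
      "\<forall>s. poly (pderiv q) s = dot (g2 (v + s \<bullet> w)) w" using gradient_polyE[OF g2, where v = v and w = w] .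
    show "\<exists>p. degree p \<le> n \<and> coeff p n = f1 w + f2 w \<and>
        (\<forall>s. poly p s = f1 (v + s \<bullet> w) + f2 (v + s \<bullet> w)) \<and>
        (\<forall>s. poly (pderiv p) s = dot (g1 (v + s \<bullet> w) + g2 (v + s \<bullet> w)) w)"
      by (rule exI[of _ "p + q"]) (auto simp: p q pderiv_add degree_add_le)
  qed
  then show ?case by blast
next
  case (mult m f1 n f2)
  then obtain g1 g2 where g1: "gradient m f1 g1" and g2: "gradient n f2 g2" by blast
  let ?g = "\<lambda>u. f1 u \<bullet> g2 u + f2 u \<bullet> g1 u"
  have "gradient (m + n) (\<lambda>u. f1 u * f2 u) ?g"
    unfolding gradient_def
  proof (intro conjI allI)
    fix u show "dot (?g u) u = of_nat (m + n) * (f1 u * f2 u)"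
      by (simp add: gradient_euler[OF g1] gradient_euler[OF g2] algebra_simps)
  next
    fix t u
    have "t \<bullet> ?g (t \<bullet> u) = f1 (t \<bullet> u) \<bullet> t \<bullet> g2 (t \<bullet> u) + f2 (t \<bullet> u) \<bullet> t \<bullet> g1 (t \<bullet> u)"
      by (simp add: smul_add_right mult_ac)
    also have "\<dots> = (t ^ m * f1 u) \<bullet> t ^ n \<bullet> g2 u + (t ^ n * f2 u) \<bullet> t ^ m \<bullet> g1 u"
      by (simp only: gradient_smul[OF g1] gradient_smul[OF g2] mult.hyps[THEN form_smul])
    also have "\<dots> = t ^ (m + n) \<bullet> ?g u"
      by (simp add: smul_add_right power_add mult_ac)
    finally show "t \<bullet> ?g (t \<bullet> u) = t ^ (m + n) \<bullet> ?g u" .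
  next
    fix v w
    obtain p where p: "degree p \<le> m" "coeff p m = f1 w" "\<forall>s. poly p s = f1 (v + s \<bullet> w)"
      "\<forall>s. poly (pderiv p) s = dot (g1 (v + s \<bullet> w)) w" using gradient_polyE[OF g1, where v = v and w = w] .
    obtain q where q: "degree q \<le> n" "coeff q n = f2 w" "\<forall>s. poly q s = f2 (v + s \<bullet> w)"
      "\<forall>s. poly (pderiv q) s = dot (g2 (v + s \<bullet> w)) w" using gradient_polyE[OF g2, where v = v and w = w] .
    have "degree (p * q) \<le> m + n"
      using degree_mult_le[of p q] p(1) q(1) by linarith
    then show "\<exists>p. degree p \<le> m + n \<and> coeff p (m + n) = f1 w * f2 w \<and>
        (\<forall>s. poly p s = f1 (v + s \<bullet> w) * f2 (v + s \<bullet> w)) \<and>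
        (\<forall>s. poly (pderiv p) s = dot (?g (v + s \<bullet> w)) w)"
      by (intro exI[of _ "p * q"]) (auto simp: p q pderiv_mult coeff_mult_degree_le)
  qed
  then show ?case by blast
qed

text \<open>\<open>P v\<close> is the Taylor expansion at \<open>u\<close> in direction
  \<open>v\<close>. Its coefficient at j is a form of degree j in \<open>v\<close>, so zeros of that
  coefficient can be counted like points of a curve; \<open>u\<close> has multiplicity at least m if
  the coefficients below m vanish.\<close>

definition expansion ::
  "nat \<Rightarrow> ('a::idom \<times> 'a \<times> 'a \<Rightarrow> 'a) \<Rightarrow> 'a \<times> 'a \<times> 'a \<Rightarrow> ('a \<times> 'a \<times> 'a \<Rightarrow> 'a poly) \<Rightarrow> bool" where
  "expansion d f u P \<longleftrightarrow>
    (\<forall>j. form j (\<lambda>v. coeff (P v) j)) \<and> (\<forall>v. degree (P v) \<le> d) \<and> (\<forall>v. coeff (P v) d = f v) \<and>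
    (\<forall>v s. poly (P v) s = f (u + s \<bullet> v))"

lemma expansionD:
  assumes "expansion d f u P"
  shows "form j (\<lambda>v. coeff (P v) j)" "degree (P v) \<le> d" "coeff (P v) d = f v"
    "poly (P v) s = f (u + s \<bullet> v)"
  using assms by (simp_all add: expansion_def)

lemma form_expansion:
  fixes f :: "'a::idom \<times> 'a \<times> 'a \<Rightarrow> 'a"
  assumes "form d f"
  shows "\<exists>P. expansion d f u P"
  using assms
proof induction
  case (const k)
  have "form j (\<lambda>v. coeff [:k:] j)" for j
    by (cases j) (simp_all add: form.const form_zero)
  then have "expansion 0 (\<lambda>_. k) u (\<lambda>_. [:k:])" unfolding expansion_def by simp
  then show ?case by blast
next
  case (linear a)
  have "form j (\<lambda>v. coeff [:dot a u, dot a v:] j)" for j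
  proof (cases j)
    case (Suc i)
    then show ?thesis using form.linear[of a] by (cases i) (simp_all add: form_zero)
  qed (simp add: form.const)
  then have "expansion 1 (dot a) u (\<lambda>v. [:dot a u, dot a v:])" unfolding expansion_def by simp
  then show ?case by blast
next
  case (add n f1 f2)
  then obtain P Q where P: "expansion n f1 u P" and Q: "expansion n f2 u Q" by blast
  have "form j (\<lambda>v. coeff (P v + Q v) j)" for j
    unfolding coeff_add by (rule form.add[OF expansionD(1)[OF P] expansionD(1)[OF Q]])
  then have "expansion n (\<lambda>u. f1 u + f2 u) u (\<lambda>v. P v + Q v)"
    by (simp add: expansion_def expansionD[OF P] expansionD[OF Q] degree_add_le)
  then show ?case by blast
next
  case (mult m f1 n f2)
  then obtain P Q where P: "expansion m f1 u P" and Q: "expansion n f2 u Q" by blast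
  have "form j (\<lambda>v. coeff (P v * Q v) j)" for j
    unfolding coeff_mult
  proof (rule form_sum)
    fix i assume "i \<in> {..j}"
    with form.mult[OF expansionD(1)[OF P, of i] expansionD(1)[OF Q, of "j - i"]]
    show "form j (\<lambda>v. coeff (P v) i * coeff (Q v) (j - i))" by simp
  qed
  moreover have "degree (P v * Q v) \<le> m + n" for v
    using degree_mult_le[of "P v" "Q v"] expansionD(2)[OF P, of v] expansionD(2)[OF Q, of v]
    by linarith
  ultimately have "expansion (m + n) (\<lambda>u. f1 u * f2 u) u (\<lambda>v. P v * Q v)"
    by (simp add: expansion_def expansionD[OF P] expansionD[OF Q] coeff_mult_degree_le)
  then show ?case by blast
qed

text \<open>The orders of the roots sum to at most the degree, and a common root of \<open>p\<close>
  and its derivative has order at least 2.\<close>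

lemma card_roots_double_roots_le:
  fixes p :: "'a::{idom, finite} poly"
  assumes "p \<noteq> 0"
  shows "card {s. poly p s = 0} + card {s. poly p s = 0 \<and> poly (pderiv p) s = 0} \<le> degree p"
proof -
  have "2 \<le> order s p" if s: "poly p s = 0" "poly (pderiv p) s = 0" for s
  proof -
    obtain r where r: "p = [:- s, 1:] * r" using s(1) unfolding poly_eq_0_iff_dvd dvd_def by blast
    have "poly (pderiv p) s = poly r s"
      unfolding r pderiv_mult by (simp add: pderiv_pCons)
    then have "poly r s = 0" using s(2) by simp
    then obtain t where t: "r = [:- s, 1:] * t" unfolding poly_eq_0_iff_dvd dvd_def by blast
    have "[:- s, 1:] ^ 2 dvd p"
      unfolding r t power2_eq_square mult.assoc[symmetric] by (rule dvd_triv_left)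
    with assms show ?thesis by (simp add: order_divides)
  qed
  moreover have "1 \<le> order s p" if "poly p s = 0" for s
    using that assms by (metis One_nat_def Suc_leI neq0_conv order_root)
  ultimately have "1 + of_bool (poly (pderiv p) s = 0) \<le> order s p" if "poly p s = 0" for s
    using that by (cases "poly (pderiv p) s = 0") (auto simp: numeral_2_eq_2)
  then have "(\<Sum>s | poly p s = 0. 1 + of_bool (poly (pderiv p) s = 0)) \<le> (\<Sum>s | poly p s = 0. order s p)"
    by (intro sum_mono) simp
  also have "\<dots> = size (proots p)"
    using assms by (simp add: size_multiset_overloaded_eq)
  also have "\<dots> \<le> degree p" by (rule size_proots_le)
  finally show ?thesis unfolding sum.distrib by (simp add: Int_def)
qed

text \<open>The point \<open>w\<close>, which is off the curve, is put at infinity on the line. All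
  zeros of \<open>f\<close> there are then nonzero multiples of \<open>v + s \<bullet> w\<close>
  with \<open>s\<close> a root of \<open>p\<close>, and \<open>p\<close> is nonzero because its top
  coefficient is \<open>f w\<close>. The condition \<open>perp a \<subseteq> perp (g u)\<close>
  expresses tangency at \<open>u\<close>, singular points included, and makes the root
  double.\<close>

lemma card_zeros_perp_tangent:
  fixes f :: "'a::{field, finite} \<times> 'a \<times> 'a \<Rightarrow> 'a"
  assumes "form d f" "gradient d f g" "a \<noteq> 0" "w \<in> perp a" "w \<noteq> 0" "f w \<noteq> 0"
  shows "card {u \<in> perp a - {0}. f u = 0} +
    card {u \<in> perp a - {0}. f u = 0 \<and> perp a \<subseteq> perp (g u)} \<le> (CARD('a) - 1) * d"
proof -
  obtain v where v: "v \<in> perp a" and bij: "bij_betw (\<lambda>(t, s). t \<bullet> v + s \<bullet> w) UNIV (perp a)"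
    using basis_perp_extend[OF assms(3-5)] .
  obtain p where p: "degree p \<le> d" "coeff p d = f w" "\<forall>s. poly p s = f (v + s \<bullet> w)"
    "\<forall>s. poly (pderiv p) s = dot (g (v + s \<bullet> w)) w" using gradient_polyE[OF assms(2), where v = v and w = w] .
  let ?R = "{s. poly p s = 0}" and ?T = "{s. poly p s = 0 \<and> poly (pderiv p) s = 0}"
  let ?h = "\<lambda>(t, s). t \<bullet> (v + s \<bullet> w)"
  have par: "\<exists>t s. t \<noteq> 0 \<and> u = t \<bullet> (v + s \<bullet> w) \<and> poly p s = 0"
    if u: "u \<in> perp a" "u \<noteq> 0" "f u = 0" for u
  proof -
    have "u \<in> range (\<lambda>(t, s). t \<bullet> v + s \<bullet> w)" using u(1) bij by (simp add: bij_betw_def)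
    then obtain t s where ts: "u = t \<bullet> v + s \<bullet> w" by auto
    have "t \<noteq> 0"
    proof
      assume "t = 0"
      with ts u have "s \<noteq> 0" "f (s \<bullet> w) = 0" by auto
      with assms show False by (simp add: form_smul)
    qed
    then have "u = t \<bullet> (v + (s / t) \<bullet> w)" using ts by (simp add: smul_add_right)
    moreover from this have "f (v + (s / t) \<bullet> w) = 0"
      using u(3) \<open>t \<noteq> 0\<close> assms(1) by (simp add: form_smul)
    ultimately show ?thesis using \<open>t \<noteq> 0\<close> p(3) by metis
  qed
  have "card {u \<in> perp a - {0}. f u = 0} \<le> card (?h ` ((- {0}) \<times> ?R))"
  proof (rule card_mono)
    show "{u \<in> perp a - {0}. f u = 0} \<subseteq> ?h ` ((- {0}) \<times> ?R)"
    proof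
      fix u assume "u \<in> {u \<in> perp a - {0}. f u = 0}"
      then obtain t s where "t \<noteq> 0" "u = t \<bullet> (v + s \<bullet> w)" "poly p s = 0" using par by blast
      then show "u \<in> ?h ` ((- {0}) \<times> ?R)" by (intro image_eqI[of _ _ "(t, s)"]) auto
    qed
  qed simp
  also have "\<dots> \<le> card ((- {0 :: 'a}) \<times> ?R)" by (rule card_image_le) simp
  finally have 1: "card {u \<in> perp a - {0}. f u = 0} \<le> (CARD('a) - 1) * card ?R"
    by (simp add: card_cartesian_product Compl_eq_Diff_UNIV card_Diff_singleton)
  have "{u \<in> perp a - {0}. f u = 0 \<and> perp a \<subseteq> perp (g u)} \<subseteq> ?h ` ((- {0}) \<times> ?T)"
  proof
    fix u assume u: "u \<in> {u \<in> perp a - {0}. f u = 0 \<and> perp a \<subseteq> perp (g u)}"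
    then obtain t s where ts: "t \<noteq> 0" "u = t \<bullet> (v + s \<bullet> w)" "poly p s = 0" using par by blast
    \<comment> \<open>Homogeneity of the gradient carries tangency from \<open>u\<close> to its
      representative \<open>v + s \<bullet> w\<close>.\<close>
    have "t ^ d * dot (g (v + s \<bullet> w)) w = dot (t ^ d \<bullet> g (v + s \<bullet> w)) w" by simp
    also have "\<dots> = dot (t \<bullet> g u) w" by (simp only: gradient_smul[OF assms(2)] ts(2))
    also have "\<dots> = 0" using u assms(4) by auto
    finally have "poly (pderiv p) s = 0" using ts(1) p(4) by simp
    with ts show "u \<in> ?h ` ((- {0}) \<times> ?T)" by (intro image_eqI[of _ _ "(t, s)"]) auto
  qed
  then have "card {u \<in> perp a - {0}. f u = 0 \<and> perp a \<subseteq> perp (g u)} \<le> card (?h ` ((- {0}) \<times> ?T))"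
    by (rule card_mono[rotated]) simp
  also have "\<dots> \<le> card ((- {0 :: 'a}) \<times> ?T)" by (rule card_image_le) simp
  finally have 2: "card {u \<in> perp a - {0}. f u = 0 \<and> perp a \<subseteq> perp (g u)} \<le> (CARD('a) - 1) * card ?T"
    by (simp add: card_cartesian_product Compl_eq_Diff_UNIV card_Diff_singleton)
  have "p \<noteq> 0" using p(2) assms(6) by auto
  then have "(CARD('a) - 1) * (card ?R + card ?T) \<le> (CARD('a) - 1) * d"
    using card_roots_double_roots_le[of p] p(1) by (intro mult_le_mono2) linarith
  with 1 2 show ?thesis by (simp add: distrib_left)
qed

lemma card_zeros_perp:
  fixes f :: "'a::{field, finite} \<times> 'a \<times> 'a \<Rightarrow> 'a"
  assumes "form d f" "a \<noteq> 0" "w \<in> perp a" "w \<noteq> 0" "f w \<noteq> 0"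
  shows "card {u \<in> perp a - {0}. f u = 0} \<le> (CARD('a) - 1) * d"
proof -
  obtain g where "gradient d f g" using form_gradient[OF assms(1)] by blast
  from card_zeros_perp_tangent[OF assms(1) this assms(2-)] show ?thesis by linarith
qed

section \<open>Counting points and tangent lines\<close>

text \<open>Double counting of pairs of a point and a line through it, tangent pairs counted twice.
  Each point of \<open>X\<close> lies on q + 1 lines, at least one of them tangent, which gives q +
  2. The set \<open>A\<close> is a parameter so that a line contained in the curve can be left
  out.\<close>

lemma card_tangent_incidences:
  fixes f :: "'a::{field, finite} \<times> 'a \<times> 'a \<Rightarrow> 'a"
  assumes grad: "gradient d f g"
    and X: "\<And>u. u \<in> X \<Longrightarrow> u \<noteq> 0 \<and> f u = 0"
    and A: "\<And>a u. u \<in> X \<Longrightarrow> a \<noteq> 0 \<Longrightarrow> dot a u = 0 \<Longrightarrow> a \<in> A"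
    and B: "\<And>a. a \<in> A \<Longrightarrow>
      card {u \<in> X. dot a u = 0} + card {u \<in> X. dot a u = 0 \<and> perp a \<subseteq> perp (g u)} \<le> B"
  shows "card X * ((CARD('a) - 1) * (CARD('a) + 2)) \<le> card A * B"
proof -
  have "(CARD('a) - 1) * (CARD('a) + 2) \<le>
      card {a \<in> A. dot a u = 0} + card {a \<in> A. dot a u = 0 \<and> perp a \<subseteq> perp (g u)}"
    if u: "u \<in> X" for u
  proof -
    have u0: "u \<noteq> 0" "f u = 0" using X[OF u] by auto
    have "(CARD('a) - 1) * (CARD('a) + 1) = card (perp u - {0})"
      using card_perp_minus_zero[OF u0(1)] by simp
    also have "\<dots> \<le> card {a \<in> A. dot a u = 0}"
      by (rule card_mono) (use A[OF u] in \<open>auto simp: dot_commute[of u]\<close>)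
    finally have 1: "(CARD('a) - 1) * (CARD('a) + 1) \<le> card {a \<in> A. dot a u = 0}" .
    have 2: "CARD('a) - 1 \<le> card {a \<in> A. dot a u = 0 \<and> perp a \<subseteq> perp (g u)}"
    \<comment> \<open>At a singular point every line through \<open>u\<close> is tangent. Otherwise
      the line \<open>g u\<close> is tangent, and it passes through \<open>u\<close> by Euler's
      identity.\<close>
    proof (cases "g u = 0")
      case True
      have "CARD('a) - 1 \<le> (CARD('a) - 1) * (CARD('a) + 1)" by simp
      also note 1
      finally show ?thesis using True by simp
    next
      case False
      have "dot (g u) u = 0" using gradient_euler[OF grad] u0 by simp
      then have "(\<lambda>l. l \<bullet> g u) ` (- {0}) \<subseteq> {a \<in> A. dot a u = 0 \<and> perp a \<subseteq> perp (g u)}"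
        by (intro image_subsetI CollectI conjI A[OF u]) (use False in auto)
      from card_mono[OF _ this] show ?thesis using card_punctured_line[OF False] by simp
    qed
    from 1 2 show ?thesis by (simp add: distrib_left)
  qed
  then have "card X * ((CARD('a) - 1) * (CARD('a) + 2)) \<le>
      (\<Sum>u\<in>X. card {a \<in> A. dot a u = 0} + card {a \<in> A. dot a u = 0 \<and> perp a \<subseteq> perp (g u)})"
    using sum_bounded_below[of X "(CARD('a) - 1) * (CARD('a) + 2)"] by simp
  also have "\<dots> = (\<Sum>a\<in>A. card {u \<in> X. dot a u = 0} + card {u \<in> X. dot a u = 0 \<and> perp a \<subseteq> perp (g u)})"
    unfolding sum.distrib
    by (intro arg_cong2[of _ _ _ _ "(+)"] sum_multicount_gen[symmetric]) auto
  also have "\<dots> \<le> card A * B"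
    using sum_bounded_above[of A _ B] B by simp
  finally show ?thesis .
qed

lemma card_zeros_at_most_one_line:
  fixes f :: "'a::{field, finite} \<times> 'a \<times> 'a \<Rightarrow> 'a"
  assumes f: "form d f" and d: "1 \<le> d" "d \<le> CARD('a)"
    and lines: "\<And>a b. a \<noteq> 0 \<Longrightarrow> b \<noteq> 0 \<Longrightarrow> \<forall>u\<in>perp a. f u = 0 \<Longrightarrow> \<forall>u\<in>perp b. f u = 0 \<Longrightarrow> perp a = perp b"
  shows "card {u. u \<noteq> 0 \<and> f u = 0} \<le> (CARD('a) - 1) * (d * CARD('a) - d + 3)"
proof -
  define q where "q = CARD('a)"
  define Z where "Z = {u. u \<noteq> 0 \<and> f u = 0}"
  have q: "2 \<le> q" using card_field_ge_2[where 'a = 'a] by (simp add: q_def)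
  then obtain r where r: "q = Suc r" by (cases q) auto
  obtain g where g: "gradient d f g" using form_gradient[OF f] by blast
  have f0: "f 0 = 0" using form_smul[OF f, of 0 0] d(1) by (simp add: power_0_left)
  have cardV: "card (- {0 :: 'a \<times> 'a \<times> 'a}) = (q - 1) * (q * q + q + 1)"
    by (simp add: Compl_eq_Diff_UNIV card_Diff_singleton q_def[symmetric] r algebra_simps)
  have bound: "card {u \<in> Z. dot a u = 0} + card {u \<in> Z. dot a u = 0 \<and> perp a \<subseteq> perp (g u)} \<le> (q - 1) * d"
    if a: "a \<noteq> 0" "\<not> (\<forall>u\<in>perp a. f u = 0)" for a
  proof -
    obtain w where w: "w \<in> perp a" "f w \<noteq> 0" using a(2) by blast
    then have "w \<noteq> 0" using f0 by auto
    have "{u \<in> Z. dot a u = 0} = {u \<in> perp a - {0}. f u = 0}"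
      "{u \<in> Z. dot a u = 0 \<and> perp a \<subseteq> perp (g u)} =
        {u \<in> perp a - {0}. f u = 0 \<and> perp a \<subseteq> perp (g u)}"
      by (auto simp: Z_def)
    then show ?thesis using card_zeros_perp_tangent[OF f g a(1) w(1) \<open>w \<noteq> 0\<close> w(2)]
      by (simp add: q_def)
  qed
  have "cone Z" using f by (auto simp: cone_def Z_def form_smul)
  have "card Z \<le> (q - 1) * (d * q - d + 3)"
  proof (cases "\<exists>a. a \<noteq> 0 \<and> (\<forall>u\<in>perp a. f u = 0)")
    case False
    define N where "N = card (Z // proj_rel)"
    have N: "card Z = (q - 1) * N" using card_cone[OF \<open>cone Z\<close>] by (simp add: q_def N_def)
    have "card Z * ((q - 1) * (q + 2)) \<le> card (- {0 :: 'a \<times> 'a \<times> 'a}) * ((q - 1) * d)"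
      unfolding q_def
    proof (rule card_tangent_incidences[OF g])
      show "card {u \<in> Z. dot a u = 0} + card {u \<in> Z. dot a u = 0 \<and> perp a \<subseteq> perp (g u)}
          \<le> (CARD('a) - 1) * d" if "a \<in> - {0}" for a
        using bound[of a] that False unfolding q_def by blast
    qed (auto simp: Z_def)
    then have "(q - 1) * (q - 1) * (N * (q + 2)) \<le> (q - 1) * (q - 1) * ((q * q + q + 1) * d)"
      unfolding cardV N by (simp only: mult_ac)
    then have le: "N * (q + 2) \<le> (q * q + q + 1) * d" using q by simp
    have "N \<le> d * q - d + 3"
    proof (rule ccontr)
      assume "\<not> N \<le> d * q - d + 3"
      then have "d * r + 4 \<le> N" by (simp add: r)
      then have "(d * r + 4) * (q + 2) \<le> N * (q + 2)" by (rule mult_le_mono1)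
      with le have "(d * r + 4) * (q + 2) \<le> (q * q + q + 1) * d" by linarith
      \<comment> \<open>With q = r + 1 the terms d r^2 + 3 d r cancel. What remains is 4 r + 12
        \<le> 3 d, contrary to d \<le> r + 1.\<close>
      then show False using d(2) unfolding q_def[symmetric] r by (simp add: algebra_simps)
    qed
    then show ?thesis unfolding N by (rule mult_le_mono2)
  next
    case True
    then obtain a where a: "a \<noteq> 0" "\<forall>u\<in>perp a. f u = 0" by blast
    define X where "X = Z - perp a"
    define M where "M = card (X // proj_rel)"
    \<comment> \<open>All lines except \<open>a\<close> itself: q^2 + q of them, each represented by
      q - 1 vectors.\<close>
    define A where "A = - {0} - (\<lambda>l. l \<bullet> a) ` (- {0})"
    have "cone X" using f by (auto simp: cone_def X_def Z_def form_smul)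
    then have M: "card X = (q - 1) * M" using card_cone by (simp add: q_def M_def)
    have "card A = card (- {0 :: 'a \<times> 'a \<times> 'a}) - card ((\<lambda>l. l \<bullet> a) ` (- {0}))"
      unfolding A_def by (rule card_Diff_subset) (use a in auto)
    then have cardA: "card A = (q - 1) * (q * q + q)"
      unfolding cardV card_punctured_line[OF a(1)] q_def[symmetric] by (simp add: r)
    have "card X * ((q - 1) * (q + 2)) \<le> card A * ((q - 1) * (d - 1))"
      unfolding q_def
    proof (rule card_tangent_incidences[OF g])
      show "u \<noteq> 0 \<and> f u = 0" if "u \<in> X" for u using that by (auto simp: X_def Z_def)
      show "b \<in> A" if "u \<in> X" "b \<noteq> 0" "dot b u = 0" for b u
        using that by (auto simp: X_def A_def)
    next
      fix b assume "b \<in> A"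
      then have b: "b \<noteq> 0" by (simp add: A_def)
      show "card {u \<in> X. dot b u = 0} + card {u \<in> X. dot b u = 0 \<and> perp b \<subseteq> perp (g u)}
          \<le> (CARD('a) - 1) * (d - 1)"
      proof (cases "\<forall>u\<in>perp b. f u = 0")
        case True
        then have "perp b = perp a" using lines[OF b a(1) _ a(2)] by blast
        then have "{u \<in> X. dot b u = 0} = {}" by (auto simp: X_def)
        moreover from this have "{u \<in> X. dot b u = 0 \<and> perp b \<subseteq> perp (g u)} = {}" by blast
        ultimately show ?thesis by (simp only: card.empty)
      next
        case False
        \<comment> \<open>The line \<open>b\<close> meets the contained line \<open>a\<close> in
          \<open>y\<close>, a point of the curve outside \<open>X\<close>. Removing its q - 1
          vectors lowers the bound from d to d - 1.\<close>
        obtain y where y: "y \<noteq> 0" "dot a y = 0" "dot b y = 0" using exists_common_perp .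
        let ?L = "(\<lambda>l. l \<bullet> y) ` (- {0})"
        have "card {u \<in> X. dot b u = 0} + card ?L = card ({u \<in> X. dot b u = 0} \<union> ?L)"
          by (rule card_Un_disjoint[symmetric]) (use y in \<open>auto simp: X_def\<close>)
        also have "\<dots> \<le> card {u \<in> Z. dot b u = 0}"
          by (rule card_mono) (use y a(2) in \<open>auto simp: X_def Z_def\<close>)
        finally have "card {u \<in> X. dot b u = 0} + (q - 1) \<le> card {u \<in> Z. dot b u = 0}"
          using card_punctured_line[OF y(1)] by (simp add: q_def)
        moreover have "card {u \<in> X. dot b u = 0 \<and> perp b \<subseteq> perp (g u)} \<le>
            card {u \<in> Z. dot b u = 0 \<and> perp b \<subseteq> perp (g u)}"
          by (rule card_mono) (auto simp: X_def)
        moreover have "(q - 1) * d = (q - 1) * (d - 1) + (q - 1)"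
          using d(1) by (cases d) auto
        ultimately show ?thesis using bound[OF b False] unfolding q_def by linarith
      qed
    qed
    then have "(q - 1) * (q - 1) * (M * (q + 2)) \<le> (q - 1) * (q - 1) * ((q * q + q) * (d - 1))"
      unfolding cardA M by (simp only: mult_ac)
    then have le: "M * (q + 2) \<le> (q * q + q) * (d - 1)" using q by simp
    obtain e where e: "d = Suc e" using d(1) by (cases d) auto
    \<comment> \<open>This is what the q + 1 points of the contained line leave of d q - d + 3 = d r
      + 3. Failure would give 2 r + 6 \<le> 2 e after cancellation, although e \<le> r.\<close>
    have "M \<le> e * r + 1"
    proof (rule ccontr)
      assume "\<not> M \<le> e * r + 1"
      then have "(e * r + 2) * (q + 2) \<le> M * (q + 2)" by (intro mult_le_mono1) simp
      with le have "(e * r + 2) * (q + 2) \<le> (q * q + q) * e" by (simp add: e)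
      then show False using d(2) unfolding q_def[symmetric] r e by (simp add: algebra_simps)
    qed
    then have "q + 1 + M \<le> d * q - d + 3" by (simp add: r e)
    moreover have "card Z = (q - 1) * (q + 1 + M)"
    proof -
      have "Z = (perp a - {0}) \<union> X" using a by (auto simp: X_def Z_def)
      moreover have "card ((perp a - {0}) \<union> X) = card (perp a - {0}) + card X"
        by (rule card_Un_disjoint) (auto simp: X_def)
      ultimately show ?thesis
        using card_perp_minus_zero[OF a(1)] M by (simp only: q_def distrib_left)
    qed
    ultimately show ?thesis by (simp only: mult_le_mono2)
  qed
  then show ?thesis by (simp add: q_def Z_def)
qed

section \<open>Pencils of lines contained in the curve\<close>

text \<open>The line \<open>perp e\<close> misses \<open>p\<close>, so its points index the lines
  through \<open>p\<close>. The multiples of \<open>p\<close> give the summand q - 1; every other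
  vector belongs to exactly one \<open>v\<close>.\<close>

lemma card_zeros_pencil:
  fixes f :: "'a::{field, finite} \<times> 'a \<times> 'a \<Rightarrow> 'a"
  assumes f: "form d f" and e: "dot e p \<noteq> 0" and p: "f p = 0"
  shows "card {u. u \<noteq> 0 \<and> f u = 0} =
    (CARD('a) - 1) + (\<Sum>v\<in>perp e - {0}. card {s. f (v + s \<bullet> p) = 0})"
proof -
  let ?h = "\<lambda>(v, s). v + s \<bullet> p"
  let ?D = "{0} \<times> (- {0}) \<union> Sigma (perp e - {0}) (\<lambda>v. {s. f (v + s \<bullet> p) = 0})"
  have p0: "p \<noteq> 0" using e by auto
  have inj: "inj_on ?h (perp e \<times> UNIV)" and surj: "?h ` (perp e \<times> UNIV) = UNIV"
    using bij_betw_perp_times_line[OF e] by (auto simp: bij_betw_def)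
  have "{u. u \<noteq> 0 \<and> f u = 0} = ?h ` ?D"
  proof (intro set_eqI iffI)
    fix u assume u: "u \<in> {u. u \<noteq> 0 \<and> f u = 0}"
    obtain v s where vs: "v \<in> perp e" "u = v + s \<bullet> p" 
    proof -
      have "u \<in> ?h ` (perp e \<times> UNIV)" using surj by simp
      then show thesis using that by auto
    qed
    then have "(v, s) \<in> ?D" using u by auto
    then show "u \<in> ?h ` ?D" using vs(2) by (intro image_eqI[of _ _ "(v, s)"]) auto
  next
    fix u assume "u \<in> ?h ` ?D"
    then obtain v s where vs: "(v, s) \<in> ?D" "u = v + s \<bullet> p" by auto
    show "u \<in> {u. u \<noteq> 0 \<and> f u = 0}"
    proof (cases "v = 0")
      case True
      then show ?thesis using vs p p0 form_smul[OF f] by auto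
    next
      case False
      have "u \<noteq> 0"
      proof
        assume "u = 0"
        then have "?h (v, s) = ?h (0, 0)" using vs by simp
        then have "(v, s) = (0, 0)" by (rule inj_onD[OF inj]) (use vs in auto)
        with False show False by simp
      qed
      then show ?thesis using vs False by auto
    qed
  qed
  moreover have "inj_on ?h ?D" by (rule inj_on_subset[OF inj]) auto
  ultimately have "card {u. u \<noteq> 0 \<and> f u = 0} = card ?D" by (simp add: card_image)
  also have "\<dots> = card ({0 :: 'a \<times> 'a \<times> 'a} \<times> (- {0 :: 'a})) +
      card (Sigma (perp e - {0}) (\<lambda>v. {s. f (v + s \<bullet> p) = 0}))"
    by (rule card_Un_disjoint) auto
  finally show ?thesis
    by (simp add: card_cartesian_product Compl_eq_Diff_UNIV card_Diff_singleton)
qed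

text \<open>If \<open>m\<close> lines of the pencil at \<open>p\<close> lie in the curve, then the coefficients of degree below
  \<open>m\<close> of the expansion at \<open>p\<close> are binary forms with too many zeros, so \<open>p\<close> is a point of
  multiplicity at least \<open>m\<close>.\<close>

lemma card_zeros_line_of_pencil:
  fixes f :: "'a::{field, finite} \<times> 'a \<times> 'a \<Rightarrow> 'a"
  assumes f: "form d f" and d: "1 \<le> d" "d \<le> CARD('a)" and e: "dot e p \<noteq> 0" and p: "f p = 0"
    and m: "card {v \<in> perp e - {0}. \<forall>s. f (v + s \<bullet> p) = 0} = (CARD('a) - 1) * m" "m \<le> d"
    and v: "v \<in> perp e" "v \<noteq> 0" "\<exists>s. f (v + s \<bullet> p) \<noteq> 0"
  shows "card {s. f (v + s \<bullet> p) = 0} \<le> d - m"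
proof -
  obtain P where P: "expansion d f p P" using form_expansion[OF f] by blast
  have e0: "e \<noteq> 0" using e by auto
  \<comment> \<open>Vanishing as a function becomes vanishing as a polynomial:
    \<open>f w = 0\<close> removes the top coefficient, and a nonzero polynomial of degree below d
    \<le> q cannot vanish at all q scalars.\<close>
  have "P w = 0" if w: "\<forall>s. f (w + s \<bullet> p) = 0" for w
  proof (rule ccontr)
    assume nz: "P w \<noteq> 0"
    have "f w = 0" using w[rule_format, of 0] by simp
    then have "coeff (P w) d = 0" using expansionD(3)[OF P] by simp
    then have "degree (P w) \<noteq> d" using nz d(1) leading_coeff_0_iff by metis
    then have lt: "degree (P w) < d" using expansionD(2)[OF P, of w] by simp
    have "poly (P w) s = 0" for s
    proof (cases "s = 0")
      case True
      then show ?thesis using p expansionD(4)[OF P] by simp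
    next
      case False
      then have "p + s \<bullet> w = s \<bullet> (w + inverse s \<bullet> p)" by (simp add: smul_add_right add.commute)
      then show ?thesis using w form_smul[OF f] expansionD(4)[OF P] by simp
    qed
    then have "{s. poly (P w) s = 0} = UNIV" by auto
    then have "CARD('a) \<le> degree (P w)" using card_poly_roots_bound[OF nz] by simp
    with lt d(2) show False by simp
  qed
  then have sub: "{v \<in> perp e - {0}. \<forall>s. f (v + s \<bullet> p) = 0} \<subseteq> {v \<in> perp e - {0}. coeff (P v) j = 0}" for j
    by auto
  \<comment> \<open>A form of degree j that is nonzero somewhere on the line \<open>perp e\<close>
    has at most j zeros there, but the contained lines supply m > j.\<close>
  have low: "coeff (P v) j = 0" if "j < m" for j
  proof (rule ccontr)
    assume "coeff (P v) j \<noteq> 0"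
    from card_zeros_perp[OF expansionD(1)[OF P] e0 v(1,2) this]
    have "card {v \<in> perp e - {0}. coeff (P v) j = 0} \<le> (CARD('a) - 1) * j" .
    moreover have "(CARD('a) - 1) * m \<le> card {v \<in> perp e - {0}. coeff (P v) j = 0}"
      using card_mono[OF _ sub[of j]] m(1) by simp
    ultimately have "(CARD('a) - 1) * m \<le> (CARD('a) - 1) * j" by linarith
    then show False using that card_field_ge_2[where 'a = 'a] by simp
  qed
  \<comment> \<open>The reversed expansion: \<open>f (v + s \<bullet> p)\<close> is s^d times
    \<open>f (p + inverse s \<bullet> v)\<close>, so the coefficient at j moves to exponent d - j.
    At s = 0 only j = d survives, with value \<open>f v\<close>.\<close>
  define R where "R = (\<Sum>j\<in>{m..d}. monom (coeff (P v) j) (d - j))"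
  have "degree R \<le> d - m"
    unfolding R_def
    by (rule degree_sum_le) (auto intro: order_trans[OF degree_monom_le])
  have R: "poly R s = f (v + s \<bullet> p)" for s
  proof -
    have "poly R s = (\<Sum>j\<in>{m..d}. coeff (P v) j * s ^ (d - j))"
      by (simp add: R_def poly_sum poly_monom)
    also have "\<dots> = (\<Sum>j\<le>d. coeff (P v) j * s ^ (d - j))"
      by (rule sum.mono_neutral_left) (auto simp: low)
    also have "\<dots> = f (v + s \<bullet> p)"
    proof (cases "s = 0")
      case True
      have "(\<Sum>j\<le>d. coeff (P v) j * 0 ^ (d - j)) = (\<Sum>j\<in>{d}. coeff (P v) j * 0 ^ (d - j))"
        by (rule sum.mono_neutral_right) auto
      with True show ?thesis using expansionD(3)[OF P] by simp
    next
      case False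
      have "(\<Sum>j\<le>d. coeff (P v) j * s ^ (d - j)) = s ^ d * (\<Sum>j\<le>d. coeff (P v) j * inverse s ^ j)"
        unfolding sum_distrib_left
        by (rule sum.cong) (use False in \<open>auto simp: power_diff field_simps\<close>)
      also have "(\<Sum>j\<le>d. coeff (P v) j * inverse s ^ j) = poly (P v) (inverse s)"
        unfolding poly_altdef
        by (rule sum.mono_neutral_right) (use expansionD(2)[OF P, of v] in \<open>auto simp: coeff_eq_0\<close>)
      also have "s ^ d * \<dots> = f (s \<bullet> (p + inverse s \<bullet> v))"
        using expansionD(4)[OF P] form_smul[OF f] by simp
      also have "s \<bullet> (p + inverse s \<bullet> v) = v + s \<bullet> p"
        using False by (simp add: smul_add_right add.commute)
      finally show ?thesis .
    qed
    finally show ?thesis .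
  qed
  have "R \<noteq> 0" using R v(3) by auto
  from card_poly_roots_bound[OF this] \<open>degree R \<le> d - m\<close> show ?thesis by (simp add: R)
qed

lemma card_zeros_two_lines:
  fixes f :: "'a::{field, finite} \<times> 'a \<times> 'a \<Rightarrow> 'a"
  assumes f: "form d f" and d: "1 \<le> d" "d \<le> CARD('a)"
    and ab: "a \<noteq> 0" "b \<noteq> 0" "\<forall>u\<in>perp a. f u = 0" "\<forall>u\<in>perp b. f u = 0" "perp a \<noteq> perp b"
    and less: "card {u. u \<noteq> 0 \<and> f u = 0} < (CARD('a) - 1) * (d * CARD('a) + 1)"
  shows "card {u. u \<noteq> 0 \<and> f u = 0} \<le> (CARD('a) - 1) * (d * CARD('a) - d + 3)"
proof -
  define q where "q = CARD('a)"
  have q: "2 \<le> q" using card_field_ge_2[where 'a = 'a] by (simp add: q_def)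
  obtain p where p: "p \<noteq> 0" "dot a p = 0" "dot b p = 0" using exists_common_perp .
  obtain e where "dot p e \<noteq> 0" using exists_dot_nonzero[OF p(1)] .
  then have e: "dot e p \<noteq> 0" by (simp add: dot_commute)
  then have e0: "e \<noteq> 0" by auto
  have fp: "f p = 0" using ab(3) p(2) by simp
  \<comment> \<open>The points of the line \<open>perp e\<close> whose joining line with
    \<open>p\<close> lies in the curve; \<open>m\<close> counts these lines.\<close>
  define S where "S = {v \<in> perp e - {0}. \<forall>s. f (v + s \<bullet> p) = 0}"
  define m where "m = card (S // proj_rel)"
  have "cone S"
    unfolding cone_def
  proof (intro conjI ballI allI impI)
    show "0 \<notin> S" by (simp add: S_def)
    fix u and l :: 'a assume u: "u \<in> S" and l: "l \<noteq> 0"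
    have "f (l \<bullet> u + s \<bullet> p) = 0" for s
    proof -
      have "l \<bullet> u + s \<bullet> p = l \<bullet> (u + (s / l) \<bullet> p)" using l by (simp add: smul_add_right)
      then show ?thesis using u form_smul[OF f] by (simp add: S_def)
    qed
    with u l show "l \<bullet> u \<in> S" by (simp add: S_def)
  qed
  then have m: "card S = (q - 1) * m" using card_cone by (simp add: q_def m_def)
  obtain x where x: "x \<noteq> 0" "dot a x = 0" "dot e x = 0" using exists_common_perp .
  obtain y where y: "y \<noteq> 0" "dot b y = 0" "dot e y = 0" using exists_common_perp .
  have "x \<in> S" "y \<in> S" using x y p ab(3,4) by (auto simp: S_def)
  have "y \<noteq> l \<bullet> x" for l
  proof
    \<comment> \<open>If \<open>x\<close> and \<open>y\<close>, the traces of the two given lines on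
      \<open>perp e\<close>, were the same point, both lines would be spanned by it and
      \<open>p\<close>.\<close>
    assume l: "y = l \<bullet> x"
    have "x \<notin> range (\<lambda>s. s \<bullet> p)" using x e by auto
    with bij_betw_basis_perp[OF ab(1)] x p
    have "perp a = range (\<lambda>(t, s). t \<bullet> x + s \<bullet> p)" by (auto simp: bij_betw_def)
    moreover have "dot b x = 0" using y l by auto
    ultimately have "perp a \<subseteq> perp b" using p by auto
    moreover have "card (perp a) = card (perp b)" using ab card_perp by metis
    ultimately show False using ab(5) card_subset_eq[of "perp b" "perp a"] by simp
  qed
  then have "(x, y) \<notin> proj_rel" by (simp add: proj_rel_iff)
  then have "proj_rel `` {x} \<noteq> proj_rel `` {y}"
    using y eq_equiv_class[OF _ equiv_proj_rel] by blast
  moreover have "{proj_rel `` {x}, proj_rel `` {y}} \<subseteq> S // proj_rel"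
    using \<open>x \<in> S\<close> \<open>y \<in> S\<close> by (auto intro: quotientI)
  ultimately have m2: "2 \<le> m"
    using card_mono[of "S // proj_rel" "{proj_rel `` {x}, proj_rel `` {y}}"] by (simp add: m_def)
  let ?r = "\<lambda>v. card {s. f (v + s \<bullet> p) = 0}"
  have "S \<subseteq> perp e - {0}" by (auto simp: S_def)
  have "sum ?r (perp e - {0}) = sum ?r (perp e - {0} - S) + sum ?r S"
    using sum.subset_diff[OF \<open>S \<subseteq> _\<close>] by simp
  also have "sum ?r S = (\<Sum>v\<in>S. q)" by (rule sum.cong) (auto simp: S_def q_def)
  finally have Z: "card {u. u \<noteq> 0 \<and> f u = 0} = (q - 1) * (1 + m * q) + sum ?r (perp e - {0} - S)"
    using card_zeros_pencil[OF f e fp] by (simp add: m q_def[symmetric] distrib_left mult.assoc)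
  \<comment> \<open>Otherwise the contained lines through \<open>p\<close> alone give at least d q +
    1 points, against the assumption \<open>less\<close>.\<close>
  have "m < d"
  proof (rule ccontr)
    assume "\<not> m < d"
    then have "(q - 1) * (d * q + 1) \<le> (q - 1) * (1 + m * q)" by (intro mult_le_mono2) simp
    with Z less show False unfolding q_def by linarith
  qed
  have cardE: "card (perp e - {0}) = (q - 1) * (q + 1)"
    using card_perp_minus_zero[OF e0] by (simp add: q_def)
  then have "card (perp e - {0} - S) = (q - 1) * (q + 1 - m)"
    using card_Diff_subset[OF _ \<open>S \<subseteq> _\<close>] m by (simp add: diff_mult_distrib2)
  moreover have "?r v \<le> d - m" if "v \<in> perp e - {0} - S" for v
  proof (rule card_zeros_line_of_pencil[OF f d e fp])
    show "card {v \<in> perp e - {0}. \<forall>s. f (v + s \<bullet> p) = 0} = (CARD('a) - 1) * m"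
      using m by (simp add: S_def q_def)
  qed (use that \<open>m < d\<close> in \<open>auto simp: S_def\<close>)
  ultimately have "sum ?r (perp e - {0} - S) \<le> (q - 1) * (q + 1 - m) * (d - m)"
    using sum_bounded_above[of "perp e - {0} - S" ?r "d - m"] by simp
  with Z have "card {u. u \<noteq> 0 \<and> f u = 0} \<le> (q - 1) * (1 + m * q + (q + 1 - m) * (d - m))"
    by (simp add: distrib_left mult.assoc)
  also have "\<dots> \<le> (q - 1) * (d * q - d + 3)"
  proof (rule mult_le_mono2)
    \<comment> \<open>These substitutions remove all subtractions. The right side then exceeds the
      left by (m - 1)(d - m) - (d - 2) = i j.\<close>
    obtain i where i: "m = i + 2" using m2 by (metis add.commute le_Suc_ex)
    obtain j where j: "d = m + 1 + j" using \<open>m < d\<close> by (metis Suc_eq_plus1 Suc_leI le_Suc_ex)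
    obtain k where k: "q = d + k" using d(2) by (metis le_Suc_ex q_def)
    show "1 + m * q + (q + 1 - m) * (d - m) \<le> d * q - d + 3"
      unfolding k j i by (simp add: algebra_simps)
  qed
  finally show ?thesis by (simp add: q_def)
qed

section \<open>Return from vectors to projective points\<close>

theorem theorem4p1:
  fixes c :: "nat \<times> nat \<times> nat \<Rightarrow> 'a::{field, finite}"
    and d :: nat
  assumes "3 \<le> d" and "d \<le> card (UNIV :: 'a set)"
    and "hom_nonzero c d"
    and "card (curve_points c d) < d * card (UNIV :: 'a set) + 1"
  shows "card (curve_points c d) \<le> d * card (UNIV :: 'a set) - d + 3"
proof -
  let ?f = "hom_eval c d" and ?Z = "{u. u \<noteq> 0 \<and> hom_eval c d u = 0}"
  have f: "form d ?f" by (rule form_hom_eval)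
  have d: "1 \<le> d" using assms(1) by simp
  have "cone ?Z" using f by (auto simp: cone_def form_smul)
  from card_cone[OF this] have Z: "card ?Z = (CARD('a) - 1) * card (curve_points c d)"
    by (simp add: curve_points_def zero_prod_def)
  have q: "0 < CARD('a) - 1" using card_field_ge_2[where 'a = 'a] by simp
  then have less: "card ?Z < (CARD('a) - 1) * (d * CARD('a) + 1)"
    using assms(4) unfolding Z by (rule mult_less_mono2[rotated])
  have "card ?Z \<le> (CARD('a) - 1) * (d * CARD('a) - d + 3)"
  proof (cases "\<exists>a b. a \<noteq> 0 \<and> b \<noteq> 0 \<and> (\<forall>u\<in>perp a. ?f u = 0) \<and> (\<forall>u\<in>perp b. ?f u = 0) \<and> perp a \<noteq> perp b")
    case True
    then obtain a b where "a \<noteq> 0" "b \<noteq> 0" "\<forall>u\<in>perp a. ?f u = 0" "\<forall>u\<in>perp b. ?f u = 0" "perp a \<noteq> perp b"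
      by blast
    from card_zeros_two_lines[OF f d assms(2) this less] show ?thesis .
  next
    case False
    show ?thesis by (rule card_zeros_at_most_one_line[OF f d assms(2)]) (use False in blast)
  qed
  then show ?thesis using q unfolding Z by simp
qed

end
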